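(* Let $\langle\cdot,\cdot\rangle_2$ be a sesquilinear form on a complex vector space of functions on $\mathbb{R}_{>0}$ containing $\mathbf{L}_{\phi_{00}}u$ and $\mathbf{L}_{\phi_{00}}\mathbf{D}^\times u$ for all $u\in\mathscr{H}_{\mathrm{finite}}$, and let $\langle\cdot,\cdot\rangle_1$ be the related sesquilinear form on $\mathscr{H}_{\mathrm{finite}}$ given by $\langle u,v\rangle_1=\langle\mathbf{L}_{\phi_{00}}u,\mathbf{L}_{\phi_{00}}v\rangle_2$. Suppose that the operator pair $(\mathbf{L}_{\phi_{00}}\mathbf{D}^\times,\mathbf{L}_{\phi_{00}})$ is self-adjoint with respect to $\langle\cdot,\cdot\rangle_1$. Then the following hold. (a) If $\alpha\in\mathbb{C}\setminus\mathbb{R}$ and $\Xi(\alpha)=0$, then $$\|u_\alpha\|_1^2=\langle u_\alpha,u_\alpha\rangle_1=\langle\mathbf{L}_{\phi_{00}}u_\alpha,\mathbf{L}_{\phi_{00}}u_\alpha\rangle_2=0.$$ (b) If $\alpha,\beta\in\mathbb{R}$ with $\alpha\neq\beta$ and $\Xi(\alpha)=\Xi(\beta)=0$, then $$\langle u_\alpha,u_\beta\rangle_1=\langle\mathbf{L}_{\phi_{00}}u_\alpha,\mathbf{L}_{\phi_{00}}u_\beta\rangle_2=0.$$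
   Context: For $\tau\in\mathbb{C}$ with $\operatorname{Im}\tau>0$, let $\vartheta_{00}(\tau)=\sum_{n\in\mathbb{Z}}\mathrm{e}^{\mathrm{i}\pi n^2\tau}$ and $$\varTheta_{00}(\tau)=(\tau/\mathrm{i})^{1/4}\Big(\tau^2\vartheta_{00}''(\tau)+\tfrac32\tau\vartheta_{00}'(\tau)\Big),$$ with the branch of the power that is positive when $\tau/\mathrm{i}>0$. Then for $t>0$, $$\varTheta_{00}(\mathrm{i}t^2)=\pi t^{9/2}\sum_{n=1}^{\infty}n^2(2\pi n^2-3t^{-2})\,\mathrm{e}^{-\pi n^2t^2},$$ which is real and strictly positive for all $t>0$. Put $\phi_{00}(t)=-\log\varTheta_{00}(\mathrm{i}t^2)$ for $t>0$, which is real-valued. The differential operators are $\mathbf{D}^\times f(t)=\frac{t}{\mathrm{i}}f'(t)$ and, for a $C^1$-smooth function $\varphi$, $\mathbf{L}_\varphi f(t)=\mathbf{D}^\times f(t)+f(t)\,\mathbf{D}^\times\varphi(t)$. With $\zeta$ the Riemann zeta function, $\xi(s)=\frac12 s(s-1)\pi^{-s/2}\Gamma(s/2)\zeta(s)$ (an entire function, removable singularities being filled in), and $\Xi(x)=\xi(\frac12+\mathrm{i}x)$ for $x\in\mathbb{C}$. For each $\alpha\in\mathbb{C}$ with $\Xi(\alpha)=0$, put $$u_\alpha(t)=t^{-\mathrm{i}\alpha}\int_{0^+}^{t}y^{\mathrm{i}\alpha}\,\varTheta_{00}(\mathrm{i}y^2)\,\frac{\mathrm{d}y}{y},\qquad t>0.$$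 Let $\mathscr{H}_{\mathrm{finite}}$ be the space of all finite linear combinations $u=\sum_{\alpha:\Xi(\alpha)=0}c(\alpha)u_\alpha$ with complex coefficients, over all zeros $\alpha\in\mathbb{C}$ of $\Xi$ (possible non-real zeros included). Sesquilinear forms are linear in the first and conjugate-linear in the second variable; $\|u\|_1^2$ denotes $\langle u,u\rangle_1$. Definition (self-adjointness). The pair $(\mathbf{L}_{\phi_{00}}\mathbf{D}^\times,\mathbf{L}_{\phi_{00}})$ is self-adjoint with respect to the form $\langle\cdot,\cdot\rangle_1$, connected with $\langle\cdot,\cdot\rangle_2$ via $\langle u,v\rangle_1=\langle\mathbf{L}_{\phi_{00}}u,\mathbf{L}_{\phi_{00}}v\rangle_2$, if $$\langle\mathbf{L}_{\phi_{00}}\mathbf{D}^\times u,\mathbf{L}_{\phi_{00}}v\rangle_2=\langle\mathbf{L}_{\phi_{00}}u,\mathbf{L}_{\phi_{00}}\mathbf{D}^\times v\rangle_2\qquad\text{for all }u,v\in\mathscr{H}_{\mathrm{finite}}.$$ *)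

theory Defs
  imports "HOL-Complex_Analysis.Complex_Analysis" "HOL-Library.Function_Algebras"
begin

text \<open>
  A function on the positive half-line is represented by a function \<open>real \<Rightarrow> complex\<close> that vanishes
  on \<open>{..0}\<close>, so that equality of representatives is equality on \<open>{0<..}\<close>.
\<close>

definition fscale :: "complex \<Rightarrow> (real \<Rightarrow> complex) \<Rightarrow> (real \<Rightarrow> complex)" where
  "fscale c f = (\<lambda>t. c * f t)"

interpretation cfun: vector_space fscale
  by unfold_locales (auto simp: fscale_def fun_eq_iff algebra_simps)

definition pos_functions :: "(real \<Rightarrow> complex) set" where
  "pos_functions = {f. \<forall>t\<le>0. f t = 0}"

definition D_times :: "(real \<Rightarrow> complex) \<Rightarrow> real \<Rightarrow> complex" where
  "D_times f t = (if t > 0 then of_real t / \<i> * vector_derivative f (at t) else 0)"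

definition L_op :: "(real \<Rightarrow> complex) \<Rightarrow> (real \<Rightarrow> complex) \<Rightarrow> real \<Rightarrow> complex" where
  "L_op \<phi> f t = D_times f t + f t * D_times \<phi> t"

definition theta00 :: "complex \<Rightarrow> complex" where
  "theta00 \<tau> = (\<Sum>\<^sub>\<infinity>n::int. exp (\<i> * of_real pi * of_int n ^ 2 * \<tau>))"

text \<open>For \<open>Im \<tau> > 0\<close> the number \<open>\<tau> / \<i>\<close> has positive real part, and the principal branch used
  by \<open>powr\<close> is the one that is positive on the positive reals.\<close>

definition Theta00 :: "complex \<Rightarrow> complex" where
  "Theta00 \<tau> = (\<tau> / \<i>) powr (1/4) *
     (\<tau> ^ 2 * deriv (deriv theta00) \<tau> + 3/2 * \<tau> * deriv theta00 \<tau>)"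

definition phi00 :: "real \<Rightarrow> complex" where
  "phi00 t = (if t > 0 then - Ln (Theta00 (\<i> * of_real t ^ 2)) else 0)"

text \<open>The analytic continuation of the Dirichlet series to the complement of the pole \<open>1\<close>; the last
  conjunct only fixes the otherwise meaningless value at the pole.\<close>

definition zeta :: "complex \<Rightarrow> complex" where
  "zeta = (THE f. f holomorphic_on (- {1}) \<and>
                  (\<forall>s. Re s > 1 \<longrightarrow> f s = (\<Sum>n. of_nat (Suc n) powr (- s))) \<and>
                  f 1 = 0)"

text \<open>At the pole of \<open>zeta\<close> and at the poles of \<open>Gamma\<close> the product below takes a junk value, which
  \<open>remove_sings\<close> replaces by the limit.\<close>

definition xi :: "complex \<Rightarrow> complex" where
  "xi = remove_sings
          (\<lambda>s. 1/2 * s * (s - 1) * of_real pi powr (- s / 2) * Gamma (s / 2) * zeta s)"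

definition Xi :: "complex \<Rightarrow> complex" where
  "Xi x = xi (1/2 + \<i> * x)"

definition u_fun :: "complex \<Rightarrow> real \<Rightarrow> complex" where
  "u_fun \<alpha> t = (if t > 0 then
      of_real t powr (- \<i> * \<alpha>) *
      integral {0<..t} (\<lambda>y. of_real y powr (\<i> * \<alpha>) * Theta00 (\<i> * of_real y ^ 2) / of_real y)
    else 0)"

definition H_finite :: "(real \<Rightarrow> complex) set" where
  "H_finite = cfun.span {u_fun \<alpha> |\<alpha>. Xi \<alpha> = 0}"

definition sesquilinear_on ::
    "(real \<Rightarrow> complex) set \<Rightarrow> ((real \<Rightarrow> complex) \<Rightarrow> (real \<Rightarrow> complex) \<Rightarrow> complex) \<Rightarrow> bool" where
  "sesquilinear_on V B \<longleftrightarrow>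
     (\<forall>x\<in>V. \<forall>y\<in>V. \<forall>z\<in>V. B (x + y) z = B x z + B y z \<and> B z (x + y) = B z x + B z y) \<and>
     (\<forall>c. \<forall>x\<in>V. \<forall>y\<in>V. B (fscale c x) y = c * B x y \<and> B x (fscale c y) = cnj c * B x y)"

text \<open>The form \<open>B1\<close> on \<open>H_finite\<close> is the one induced by \<open>B2\<close>.\<close>

definition connected_forms ::
    "((real \<Rightarrow> complex) \<Rightarrow> (real \<Rightarrow> complex) \<Rightarrow> complex) \<Rightarrow>
     ((real \<Rightarrow> complex) \<Rightarrow> (real \<Rightarrow> complex) \<Rightarrow> complex) \<Rightarrow> bool" where
  "connected_forms B1 B2 \<longleftrightarrow>
     (\<forall>u\<in>H_finite. \<forall>v\<in>H_finite. B1 u v = B2 (L_op phi00 u) (L_op phi00 v))"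

text \<open>Self-adjointness of the pair \<open>(L D, L)\<close>, with \<open>L = L_op phi00\<close> and \<open>D = D_times\<close>, with respect to
  the form induced by \<open>B2\<close>; the condition itself involves \<open>B2\<close> only.\<close>

definition self_adjoint_pair ::
    "((real \<Rightarrow> complex) \<Rightarrow> (real \<Rightarrow> complex) \<Rightarrow> complex) \<Rightarrow> bool" where
  "self_adjoint_pair B2 \<longleftrightarrow>
     (\<forall>u\<in>H_finite. \<forall>v\<in>H_finite.
        B2 (L_op phi00 (D_times u)) (L_op phi00 v) = B2 (L_op phi00 u) (L_op phi00 (D_times v)))"

end

theory Submission
  imports Defs "HOL-Probability.Characteristic_Functions"
begin

text \<open>
  Each \<open>u_fun \<alpha>\<close> is, modulo the kernel of \<open>L_op phi00\<close>, an eigenfunction of \<open>D_times\<close>. Write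
  \<open>\<Theta>(t)\<close> for \<open>Theta00 (\<i> t\<^sup>2)\<close>. Differentiating the integral that defines \<open>u_fun \<alpha>\<close> gives
  \<open>D_times (u_fun \<alpha>) = - \<alpha> u_fun \<alpha> - \<i> \<Theta>\<close>, and \<open>L_op phi00\<close> annihilates \<open>\<Theta>\<close> because
  \<open>phi00 = - log \<Theta>\<close>. Hence \<open>L_op phi00 (D_times (u_fun \<alpha>)) = - \<alpha> L_op phi00 (u_fun \<alpha>)\<close>
  (\<open>L_op_D_times_u_fun\<close>), and the theorem is the usual argument for eigenvectors of a symmetric
  operator: \<open>(\<alpha> - cnj \<beta>) \<cdot> B2 (L u\<^sub>\<alpha>) (L u\<^sub>\<beta>) = 0\<close>. If the defining integral diverges, its value is \<open>0\<close> by
  convention, \<open>u_fun \<alpha>\<close> vanishes identically and the same identity is trivial.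

  The analytic content is that \<open>L_op phi00\<close> really annihilates \<open>\<Theta>\<close> at every \<open>t > 0\<close>, for which \<open>\<Theta>\<close> must
  have no zeros there: at a simple zero \<open>log \<Theta>\<close> is not differentiable and the cancellation fails.
  Put \<open>\<psi>(x) = \<Sum>\<^sub>n exp (- \<pi> n\<^sup>2 x)\<close> over all integers \<open>n\<close>. Then
  \<open>\<Theta>(t) = x powr (1/4) (x\<^sup>2 \<psi>''(x) + 3/2 x \<psi>'(x))\<close> with \<open>x = t\<^sup>2\<close> (\<open>Theta00_imaginary_axis\<close>). For
  \<open>x \<ge> 1\<close> the series of the second factor has positive terms, since \<open>\<pi> > 3/2\<close>. For small \<open>x\<close> the terms
  change sign and cancel to an exponentially small sum; for \<open>x < 1\<close> positivity comes from \<open>x \<ge> 1\<close> through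
  the invariance of the second factor under \<open>x \<mapsto> 1/x\<close>, up to \<open>sqrt x\<close> (\<open>theta_form_modular\<close>).
  This follows by differentiating twice Jacobi's transformation \<open>\<psi>(x) = \<psi>(1/x) / sqrt x\<close>
  (\<open>theta_transformation\<close>), which is Poisson summation for a Gaussian.
\<close>

section \<open>The Fourier transform of a Gaussian\<close>

text \<open>
  This is the characteristic function of the standard normal distribution, rescaled by
  \<open>c = sqrt (2 \<pi> t)\<close>.
\<close>

lemma gaussian_cos_lborel:
  fixes t s :: real
  assumes t: "t > 0"
  shows "integrable lborel (\<lambda>x. exp (- pi * t * x\<^sup>2) * cos (s * x))" (is "integrable _ ?g")
    and "(LINT x|lborel. exp (- pi * t * x\<^sup>2) * cos (s * x)) = exp (- s\<^sup>2 / (4 * pi * t)) / sqrt t"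
proof -
  define c where "c = sqrt (2 * pi * t)"
  have c: "c > 0" "c\<^sup>2 = 2 * pi * t" using t by (auto simp: c_def)
  define f where "f = (\<lambda>y. std_normal_density y * cos (s / c * y))"
  have "complex_of_real (exp (- ((s / c)\<^sup>2) / 2)) = (CLINT y|std_normal_distribution. iexp (s / c * y))"
    using fun_cong[OF char_std_normal_distribution, of "s / c"] by (simp only: char_def)
  also have "\<dots> = (CLINT y|lborel. std_normal_density y *\<^sub>R iexp (s / c * y))"
    by (subst integral_density) (auto simp: normal_density_nonneg)
  finally have eq: "(CLINT y|lborel. std_normal_density y *\<^sub>R iexp (s / c * y)) = exp (- ((s / c)\<^sup>2) / 2)" by simp
  have intc: "integrable lborel (\<lambda>y. std_normal_density y *\<^sub>R iexp (s / c * y))"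
    by (rule Bochner_Integration.integrable_bound[of _ "std_normal_density"])
       (auto simp: normal_density_nonneg integrable_normal_density)
  have Ref: "Re (std_normal_density y *\<^sub>R iexp (s / c * y)) = f y" for y
    using cis_conv_exp[of "s / c * y", symmetric] by (simp add: f_def del: of_real_mult of_real_divide)
  have If: "integrable lborel f"
    using integrable_Re[OF intc] by (simp only: Ref)
  have Lf: "(LINT y|lborel. f y) = exp (- ((s / c)\<^sup>2) / 2)"
    using integral_Re[OF intc] unfolding Ref eq by simp
  have g: "sqrt (2 * pi) * f (0 + c * x) = ?g x" for x
    using c by (simp add: f_def std_normal_density_def power_mult_distrib real_sqrt_mult)
  have "integrable lborel (\<lambda>x. sqrt (2 * pi) * f (0 + c * x))"
    using lborel_integrable_real_affine[OF If, of c 0] c by (intro integrable_mult_right) auto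
  thus "integrable lborel ?g" by (simp only: g)
  have "(LINT y|lborel. f y) = c * (LINT x|lborel. f (0 + c * x))"
    using lborel_integral_real_affine[of c f 0] c by simp
  hence "(LINT x|lborel. sqrt (2 * pi) * f (0 + c * x)) = sqrt (2 * pi) * exp (- ((s / c)\<^sup>2) / 2) / c"
    using c Lf by (simp add: field_simps)
  also have "\<dots> = exp (- s\<^sup>2 / (4 * pi * t)) / sqrt t"
    using t by (simp add: power_divide c(2) field_simps) (simp add: c_def real_sqrt_mult)
  finally show "(LINT x|lborel. ?g x) = exp (- s\<^sup>2 / (4 * pi * t)) / sqrt t"
    by (simp only: g)
qed

lemma gaussian_cos_limit:
  fixes t s :: real
  assumes t: "t > 0"
  shows "(\<lambda>N. integral {- (real N + 1/2)..real N + 1/2} (\<lambda>x. exp (- pi * t * x\<^sup>2) * cos (s * x)))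
           \<longlonglongrightarrow> exp (- s\<^sup>2 / (4 * pi * t)) / sqrt t"
proof -
  let ?g = "\<lambda>x. exp (- pi * t * x\<^sup>2) * cos (s * x)"
  let ?I = "\<lambda>N. {- (real N + 1/2)..real N + 1/2}"
  note gi = gaussian_cos_lborel[OF t, of s]
  have "(\<lambda>N. LINT x|lborel. indicator (?I N) x *\<^sub>R ?g x) \<longlonglongrightarrow> (LINT x|lborel. ?g x)"
  proof (rule integral_dominated_convergence[where w = "\<lambda>x. norm (?g x)"])
    show "AE x in lborel. (\<lambda>N. indicator (?I N) x *\<^sub>R ?g x) \<longlonglongrightarrow> ?g x"
    proof (rule AE_I2)
      fix x :: real
      obtain M :: nat where M: "\<bar>x\<bar> < real M" using reals_Archimedean2 by blast
      have "eventually (\<lambda>N. indicator (?I N) x *\<^sub>R ?g x = ?g x) sequentially"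
        using eventually_ge_at_top[of M] by eventually_elim (use M in \<open>auto simp: indicator_def\<close>)
      thus "(\<lambda>N. indicator (?I N) x *\<^sub>R ?g x) \<longlonglongrightarrow> ?g x" by (rule tendsto_eventually)
    qed
  qed (use gi in \<open>auto simp: indicator_def\<close>)
  moreover have "(LINT x|lborel. indicator (?I N) x *\<^sub>R ?g x) = integral (?I N) ?g" for N
  proof -
    have "set_integrable lborel (?I N) ?g"
      unfolding set_integrable_def by (intro integrable_mult_indicator gi(1)) simp
    from set_borel_integral_eq_integral(2)[OF this] show ?thesis
      by (simp add: set_lebesgue_integral_def)
  qed
  ultimately show ?thesis using gi(2) by simp
qed

section \<open>Poisson summation and Jacobi's transformation\<close>

text \<open>
  On \<open>{-(1/2)..1/2}\<close> an even continuous function is a continuous function \<open>h\<close> of \<open>cos (2 \<pi> x)\<close>. Powers of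
  \<open>cos (2 \<pi> x)\<close> are combinations of the \<open>cos (2 \<pi> k x)\<close>, so \<open>H\<close> is orthogonal to every polynomial in
  \<open>cos (2 \<pi> x)\<close>; by Weierstrass these approximate \<open>H\<close> itself uniformly, and \<open>H\<close> is orthogonal to
  itself.
\<close>

lemma vanishing_cos_coeffs_imp_zero:
  fixes H :: "real \<Rightarrow> real"
  assumes cont: "continuous_on {-(1/2)..1/2} H"
    and even: "\<And>x. H (- x) = H x"
    and coeff: "\<And>k::int. integral {-(1/2)..1/2} (\<lambda>x. H x * cos (2 * pi * k * x)) = 0"
    and x: "x \<in> {-(1/2)..1/2}"
  shows "H x = 0"
proof -
  let ?J = "{-(1/2)..1/2} :: real set"
  define h where "h = (\<lambda>c. H (arccos c / (2 * pi)))"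
  have contc: "continuous_on ?J (\<lambda>x. H x * (cos (2 * pi * x) ^ i * cos (2 * pi * k * x)))" for i and k :: int
    by (intro continuous_intros cont)
  \<comment> \<open>Multiplying by one more cosine only shifts the frequency: \<open>2 cos a cos b = cos (a + b) + cos (a - b)\<close>.\<close>
  have mom: "integral ?J (\<lambda>x. H x * (cos (2 * pi * x) ^ i * cos (2 * pi * k * x))) = 0" for i and k :: int
  proof (induction i arbitrary: k)
    case (Suc i)
    have prod: "cos (2 * pi * x) * cos (2 * pi * k * x)
        = (cos (2 * pi * of_int (k + 1) * x) + cos (2 * pi * of_int (k - 1) * x)) / 2" for x :: real
      by (simp add: algebra_simps cos_add cos_diff)
    have "(\<lambda>x. H x * (cos (2 * pi * x) ^ Suc i * cos (2 * pi * k * x)))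
       = (\<lambda>x. (1/2) * (H x * (cos (2 * pi * x) ^ i * cos (2 * pi * of_int (k + 1) * x)))
            + (1/2) * (H x * (cos (2 * pi * x) ^ i * cos (2 * pi * of_int (k - 1) * x))))"
    proof
      fix x :: real
      have "H x * (cos (2 * pi * x) ^ Suc i * cos (2 * pi * k * x))
          = H x * cos (2 * pi * x) ^ i * (cos (2 * pi * x) * cos (2 * pi * k * x))" by simp
      thus "H x * (cos (2 * pi * x) ^ Suc i * cos (2 * pi * k * x)) =
          (1/2) * (H x * (cos (2 * pi * x) ^ i * cos (2 * pi * of_int (k + 1) * x)))
            + (1/2) * (H x * (cos (2 * pi * x) ^ i * cos (2 * pi * of_int (k - 1) * x)))"
        unfolding prod by (simp add: algebra_simps)
    qed
    then show ?case
      using Suc.IH[of "k + 1"] Suc.IH[of "k - 1"]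
      by (simp only:) (subst integral_add, auto simp del: of_int_add of_int_diff
          intro!: integrable_continuous_interval continuous_intros cont)
  qed (use coeff in simp)
  have hcont: "continuous_on {-1..1} h"
    unfolding h_def
  proof (rule continuous_on_compose2[OF cont])
    show "continuous_on {-1..1} (\<lambda>c. arccos c / (2 * pi))"
      by (intro continuous_intros) auto
    show "(\<lambda>c. arccos c / (2 * pi)) ` {-1..1} \<subseteq> ?J"
      using arccos_lbound arccos_ubound by (force simp: field_simps)
  qed
  have hH: "h (cos (2 * pi * x)) = H x" if "x \<in> ?J" for x
  proof -
    have "cos (2 * pi * x) = cos (2 * pi * \<bar>x\<bar>)" by (simp add: abs_if)
    moreover have "arccos (cos (2 * pi * \<bar>x\<bar>)) = 2 * pi * \<bar>x\<bar>"
      using that by (intro arccos_cos) (auto simp: abs_if)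
    ultimately have "h (cos (2 * pi * x)) = H \<bar>x\<bar>" by (simp add: h_def)
    thus ?thesis using even[of x] by (simp add: abs_if)
  qed
  obtain B where B: "\<And>x. x \<in> ?J \<Longrightarrow> \<bar>H x\<bar> \<le> B" "B > 0"
  proof -
    have "bounded (H ` ?J)"
      by (intro compact_imp_bounded compact_continuous_image cont) simp
    then obtain b where "b > 0" "\<forall>x\<in>?J. \<bar>H x\<bar> \<le> b" by (auto simp: bounded_pos)
    thus ?thesis using that[of b] by blast
  qed
  have small: "integral ?J (\<lambda>x. H x * H x) \<le> B * e" if e: "e > 0" for e
  proof -
    obtain p where p: "real_polynomial_function p" and pe: "\<And>c. c \<in> {-1..1} \<Longrightarrow> \<bar>h c - p c\<bar> < e"
      using Stone_Weierstrass_real_polynomial_function[OF _ hcont e] by auto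
    obtain a n where pn: "p = (\<lambda>c. \<Sum>i\<le>n. a i * c ^ i)"
      using p real_polynomial_function_iff_sum by blast
    have p0: "integral ?J (\<lambda>x. H x * p (cos (2 * pi * x))) = 0"
    proof -
      have int: "(\<lambda>x. a i * (H x * (cos (2 * pi * x) ^ i * cos (2 * pi * of_int 0 * x)))) integrable_on ?J" for i
        by (intro integrable_continuous_interval continuous_on_mult_left contc)
      have "(\<lambda>x. H x * p (cos (2 * pi * x)))
          = (\<lambda>x. \<Sum>i\<le>n. a i * (H x * (cos (2 * pi * x) ^ i * cos (2 * pi * of_int 0 * x))))"
        by (simp add: pn sum_distrib_left mult_ac)
      moreover have "integral ?J (\<lambda>x. \<Sum>i\<le>n. a i * (H x * (cos (2 * pi * x) ^ i * cos (2 * pi * of_int 0 * x)))) = 0"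
        unfolding integral_sum[OF finite_atMost int] Henstock_Kurzweil_Integration.integral_mult_right mom by simp
      ultimately show ?thesis by (simp only:)
    qed
    have cp: "continuous_on ?J (\<lambda>x. H x * p (cos (2 * pi * x)))"
      unfolding pn by (intro continuous_intros cont)
    have "integral ?J (\<lambda>x. H x * H x) = integral ?J (\<lambda>x. H x * H x) - integral ?J (\<lambda>x. H x * p (cos (2 * pi * x)))"
      using p0 by simp
    also have "\<dots> = integral ?J (\<lambda>x. H x * H x - H x * p (cos (2 * pi * x)))"
      by (rule Henstock_Kurzweil_Integration.integral_diff[symmetric])
         (intro integrable_continuous_interval continuous_intros cont cp)+
    also have "\<dots> \<le> integral ?J (\<lambda>x. B * e)"
    proof (rule integral_le)
      fix x assume x: "x \<in> ?J"
      have "\<bar>H x - p (cos (2 * pi * x))\<bar> \<le> e"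
        using pe[of "cos (2 * pi * x)"] hH[OF x] by auto
      hence "\<bar>H x * (H x - p (cos (2 * pi * x)))\<bar> \<le> B * e"
        unfolding abs_mult using B(1)[OF x] B(2) by (intro mult_mono) auto
      thus "H x * H x - H x * p (cos (2 * pi * x)) \<le> B * e" by (simp add: algebra_simps)
    qed (intro integrable_continuous_interval continuous_intros cont cp)+
    finally show ?thesis by simp
  qed
  have "integral ?J (\<lambda>x. H x * H x) \<le> 0"
  proof (rule field_le_epsilon)
    fix e :: real assume "e > 0"
    thus "integral ?J (\<lambda>x. H x * H x) \<le> 0 + e" using small[of "e / B"] B(2) by simp
  qed
  moreover have "integral ?J (\<lambda>x. H x * H x) \<ge> 0"
    by (rule integral_nonneg) (auto intro!: integrable_continuous_interval continuous_intros cont)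
  ultimately have "integral ?J (\<lambda>x. H x * H x) = 0" by simp
  moreover have "continuous_on ?J (\<lambda>x. H x * H x)" by (intro continuous_intros cont)
  ultimately have "\<forall>x\<in>?J. H x * H x = 0"
    using integral_eq_0_iff[of "-(1/2)" "1/2" "\<lambda>x. H x * H x"] by simp
  thus ?thesis using x by simp
qed

lemma
  fixes g :: "nat \<Rightarrow> real \<Rightarrow> real"
  assumes cont: "\<And>n. continuous_on {a..b} (g n)"
    and bound: "\<And>n x. x \<in> {a..b} \<Longrightarrow> \<bar>g n x\<bar> \<le> M n" and M: "summable M"
  shows continuous_on_suminf_dominated: "continuous_on {a..b} (\<lambda>x. \<Sum>n. g n x)"
    and integral_sums_dominated:
      "(\<lambda>n. integral {a..b} (g n)) sums integral {a..b} (\<lambda>x. \<Sum>n. g n x)"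
proof -
  have u: "uniform_limit {a..b} (\<lambda>N x. \<Sum>n<N. g n x) (\<lambda>x. \<Sum>n. g n x) sequentially"
    by (rule Weierstrass_m_test[OF _ M]) (use bound in auto)
  have c: "continuous_on {a..b} (\<lambda>x. \<Sum>n<N. g n x)" for N
    by (intro continuous_intros cont)
  show "continuous_on {a..b} (\<lambda>x. \<Sum>n. g n x)"
    by (rule uniform_limit_theorem[OF _ u]) (auto intro!: always_eventually c)
  from uniform_limit_integral[OF u c] obtain I J
    where IJ: "\<And>N. ((\<lambda>x. \<Sum>n<N. g n x) has_integral I N) {a..b}"
      "((\<lambda>x. \<Sum>n. g n x) has_integral J) {a..b}" "I \<longlonglongrightarrow> J" by auto
  have "I N = (\<Sum>n<N. integral {a..b} (g n))" for N
    using integral_unique[OF IJ(1)[of N]]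
    by (subst (asm) integral_sum) (auto intro!: integrable_continuous_interval cont)
  hence "I = (\<lambda>N. \<Sum>n<N. integral {a..b} (g n))" by auto
  with IJ(3) integral_unique[OF IJ(2)]
  show "(\<lambda>n. integral {a..b} (g n)) sums integral {a..b} (\<lambda>x. \<Sum>n. g n x)"
    by (simp add: sums_def)
qed

lemma integral_cos_period:
  fixes m :: int
  shows "integral {-(1/2)..1/2} (\<lambda>x. cos (2 * pi * m * x)) = (if m = 0 then 1 else 0)"
proof (cases "m = 0")
  case False
  have "((\<lambda>x. cos (2 * pi * m * x)) has_integral
          (sin (2 * pi * m * (1/2)) / (2 * pi * m) - sin (2 * pi * m * (-(1/2))) / (2 * pi * m)))
        {-(1/2)..1/2}"
    using False by (intro fundamental_theorem_of_calculus)
      (auto intro!: derivative_eq_intros simp flip: has_real_derivative_iff_has_vector_derivative)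
  thus ?thesis using False sin_npi_int[of m] by (auto dest!: integral_unique simp: mult.commute)
qed simp

text \<open>
  The number of integers with absolute value \<open>n\<close>: the weight that turns the sum of an even function
  over the integers into a sum over the natural numbers.
\<close>

definition abs_multiplicity :: "nat \<Rightarrow> real" where
  "abs_multiplicity n = (if n = 0 then 1 else 2)"

lemma cos_orthogonal:
  fixes n :: nat and k :: int
  shows "integral {-(1/2)..1/2} (\<lambda>x. abs_multiplicity n * cos (2 * pi * n * x) * cos (2 * pi * k * x))
    = (if n = nat \<bar>k\<bar> then 1 else 0)"
proof -
  have "(\<lambda>x. abs_multiplicity n * cos (2 * pi * n * x) * cos (2 * pi * k * x))
      = (\<lambda>x. abs_multiplicity n / 2 * cos (2 * pi * of_int (int n + k) * x)
            + abs_multiplicity n / 2 * cos (2 * pi * of_int (int n - k) * x))"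
    by (rule ext) (simp add: algebra_simps cos_add cos_diff)
  hence "integral {-(1/2)..1/2} (\<lambda>x. abs_multiplicity n * cos (2 * pi * n * x) * cos (2 * pi * k * x))
      = abs_multiplicity n / 2 * (if int n + k = 0 then 1 else 0) + abs_multiplicity n / 2 * (if int n - k = 0 then 1 else 0)"
    by (simp only:) (subst integral_add, auto simp del: of_int_add of_int_diff
       simp add: integral_cos_period intro!: integrable_continuous_interval continuous_intros)
  also have "\<dots> = (if n = nat \<bar>k\<bar> then 1 else 0)"
    by (auto simp: abs_multiplicity_def)
  finally show ?thesis .
qed

text \<open>
  Unfolding: integrating translates of \<open>f\<close> against a periodic weight over one period is integrating \<open>f\<close>
  itself over adjacent periods. The translates by \<open>n\<close> and \<open>- n\<close> are taken together.
\<close>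

lemma integral_periodization:
  fixes f w :: "real \<Rightarrow> real"
  assumes f: "continuous_on UNIV f" and w: "continuous_on UNIV w"
    and per: "\<And>(m::int) (x::real). w (x + m) = w x"
  shows "(\<Sum>n\<le>N. integral {-(1/2)..1/2} (\<lambda>x. (if n = 0 then f x else f (x + real n) + f (x - real n)) * w x))
           = integral {-(real N + 1/2)..real N + 1/2} (\<lambda>x. f x * w x)"
proof (induction N)
  case (Suc N)
  have cont: "continuous_on A (\<lambda>x. f (x + c) * w x)" for A c
    by (intro continuous_intros continuous_on_compose2[OF f] continuous_on_subset[OF w]) auto
  note int = integrable_continuous_interval[OF cont]
  define c where "c = real (Suc N)"
  have wc: "w (x + c) = w x" "w (x - c) = w x" for x
    using per[of x "int (Suc N)"] per[of x "- int (Suc N)"] by (simp_all add: c_def algebra_simps)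
  have right: "integral {-(1/2)..1/2} (\<lambda>x. f (x + c) * w x) = integral {c - 1/2..c + 1/2} (\<lambda>x. f x * w x)"
    using integral_shift_real_ivl[of "c - 1/2" c "c + 1/2" "\<lambda>x. f x * w x"] by (simp add: wc)
  have left: "integral {-(1/2)..1/2} (\<lambda>x. f (x - c) * w x) = integral {-(c + 1/2)..-(c - 1/2)} (\<lambda>x. f x * w x)"
    using integral_shift_real_ivl[of "-(c + 1/2)" "- c" "-(c - 1/2)" "\<lambda>x. f x * w x"] by (simp add: wc)
  have "integral {-(1/2)..1/2} (\<lambda>x. (f (x + c) + f (x - c)) * w x)
     = integral {-(1/2)..1/2} (\<lambda>x. f (x + c) * w x) + integral {-(1/2)..1/2} (\<lambda>x. f (x - c) * w x)"
    using integral_add[OF int int, of "-(1/2)" "1/2" c "- c"] by (simp add: distrib_right)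
  hence step: "integral {-(1/2)..1/2} (\<lambda>x. (f (x + c) + f (x - c)) * w x) =
      integral {c - 1/2..c + 1/2} (\<lambda>x. f x * w x) + integral {-(c + 1/2)..-(c - 1/2)} (\<lambda>x. f x * w x)"
    unfolding left right .
  have int0: "(\<lambda>x. f x * w x) integrable_on {a..b}" for a b
    using int[of 0] by simp
  have c: "c \<ge> 1" by (simp add: c_def)
  have split: "integral {-(c + 1/2)..c + 1/2} (\<lambda>x. f x * w x)
    = integral {-(c + 1/2)..-(c - 1/2)} (\<lambda>x. f x * w x)
      + integral {-(c - 1/2)..c - 1/2} (\<lambda>x. f x * w x)
      + integral {c - 1/2..c + 1/2} (\<lambda>x. f x * w x)"
    using Henstock_Kurzweil_Integration.integral_combine[OF _ _ int0, of "-(c + 1/2)" "-(c - 1/2)" "c - 1/2"]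
      Henstock_Kurzweil_Integration.integral_combine[OF _ _ int0, of "-(c + 1/2)" "c - 1/2" "c + 1/2"] c
    by simp
  have cN: "c - 1/2 = real N + 1/2" by (simp add: c_def)
  have "integral {-(1/2)..1/2} (\<lambda>x. (f (x + c) + f (x - c)) * w x)
      + integral {-(real N + 1/2)..real N + 1/2} (\<lambda>x. f x * w x) = integral {-(c + 1/2)..c + 1/2} (\<lambda>x. f x * w x)"
    using step split unfolding cN by linarith
  thus ?case
    using Suc.IH by (simp only: sum.atMost_Suc c_def nat.distinct if_False refl add.commute)
qed simp

text \<open>
  Poisson summation for \<open>f(x) = exp (- \<pi> t x\<^sup>2)\<close>. The periodization \<open>F\<close> of \<open>f\<close> and the cosine series \<open>G\<close>
  built from the Fourier transform of \<open>f\<close> have the same cosine coefficients, so they agree; the claim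
  is their equality at \<open>0\<close>.
\<close>

lemma theta_transformation:
  fixes t :: real
  assumes t: "t > 0"
  shows "(\<Sum>n. abs_multiplicity n * exp (- pi * t * (real n)\<^sup>2))
       = (\<Sum>n. abs_multiplicity n * exp (- pi * (1 / t) * (real n)\<^sup>2)) / sqrt t"
proof -
  let ?J = "{-(1/2)..1/2} :: real set"
  define f where "f = (\<lambda>x. exp (- pi * t * x\<^sup>2))"
  define g where "g = (\<lambda>n x. if n = 0 then f x else f (x + real n) + f (x - real n))"
  define h where "h = (\<lambda>n x. exp (- pi * (1 / t) * (real n)\<^sup>2) / sqrt t * (abs_multiplicity n * cos (2 * pi * n * x)))"
  define F where "F = (\<lambda>x. \<Sum>n. g n x)"
  define G where "G = (\<lambda>x. \<Sum>n. h n x)"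
  have fcont: "continuous_on A (\<lambda>x. f (x + c))" for A c
    unfolding f_def by (intro continuous_intros)
  have gcont: "continuous_on A (g n)" for A n
    using fcont[of A 0] fcont[of A "real n"] fcont[of A "- real n"]
    by (cases "n = 0") (auto simp: g_def intro!: continuous_intros)
  have hcont: "continuous_on A (h n)" for A n
    unfolding h_def by (intro continuous_intros)
  \<comment> \<open>For \<open>x\<close> in the unit interval around \<open>0\<close>, the points \<open>x + n\<close> and \<open>x - n\<close> are at least \<open>n/2\<close> away from \<open>0\<close>.\<close>
  have fbound: "f y \<le> exp (- pi * t / 4) ^ n" if "\<bar>y\<bar> \<ge> real n / 2" for y n
  proof -
    have "real n \<le> (real n)\<^sup>2" by (cases n) (auto simp: power2_eq_square)
    also have "\<dots> \<le> 4 * y\<^sup>2"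
      using power_mono[OF that, of 2] by (simp add: power_divide)
    finally have "real n * (pi * t) \<le> 4 * y\<^sup>2 * (pi * t)"
      using t by (intro mult_right_mono) auto
    thus ?thesis by (simp add: f_def exp_of_nat_mult[symmetric] field_simps)
  qed
  have gbound: "\<bar>g n x\<bar> \<le> 2 * exp (- pi * t / 4) ^ n" if "x \<in> ?J" for n x
  proof (cases "n = 0")
    case False
    have "f (x + real n) \<le> exp (- pi * t / 4) ^ n" "f (x - real n) \<le> exp (- pi * t / 4) ^ n"
      using that False by (intro fbound, force)+
    moreover have "f y \<ge> 0" for y by (simp add: f_def)
    ultimately show ?thesis using False by (simp add: g_def)
  qed (use t in \<open>auto simp: g_def f_def intro: order.trans[of _ 1]\<close>)
  have hbound: "\<bar>h n x\<bar> \<le> 2 / sqrt t * exp (- pi / t) ^ n" for n x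
  proof -
    have "real n \<le> (real n)\<^sup>2" by (cases n) (auto simp: power2_eq_square)
    hence "exp (- pi * (1 / t) * (real n)\<^sup>2) \<le> exp (- pi / t) ^ n"
      using t by (simp add: exp_of_nat_mult[symmetric] field_simps)
    moreover have "\<bar>abs_multiplicity n * cos (2 * pi * n * x)\<bar> \<le> 2"
      unfolding abs_mult using abs_cos_le_one[of "2 * pi * n * x"] by (auto simp: abs_multiplicity_def)
    ultimately have "exp (- pi * (1 / t) * (real n)\<^sup>2) * \<bar>abs_multiplicity n * cos (2 * pi * n * x)\<bar> \<le> exp (- pi / t) ^ n * 2"
      by (intro mult_mono) auto
    thus ?thesis using t unfolding h_def abs_mult by (simp add: field_simps)
  qed
  have sg: "summable (\<lambda>n. 2 * exp (- pi * t / 4) ^ n)" and sh: "summable (\<lambda>n. 2 / sqrt t * exp (- pi / t) ^ n)"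
    using t by (auto intro!: summable_mult summable_geometric)
  have sumg: "summable (\<lambda>n. g n x)" if "x \<in> ?J" for x
    by (rule summable_comparison_test'[OF sg]) (use gbound that in auto)
  have sumh: "summable (\<lambda>n. h n x)" for x
    by (rule summable_comparison_test'[OF sh]) (use hbound in auto)
  have Fcont: "continuous_on ?J F" and Gcont: "continuous_on ?J G"
    unfolding F_def G_def
    by (rule continuous_on_suminf_dominated[OF gcont gbound sg], assumption)
       (rule continuous_on_suminf_dominated[OF hcont hbound sh])
  have coeffs: "integral ?J (\<lambda>x. F x * cos (2 * pi * k * x)) = exp (- pi * (1 / t) * k\<^sup>2) / sqrt t"
     "integral ?J (\<lambda>x. G x * cos (2 * pi * k * x)) = exp (- pi * (1 / t) * k\<^sup>2) / sqrt t" for k :: int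
  proof -
    let ?w = "\<lambda>x. cos (2 * pi * k * x)"
    have per: "?w (x + of_int m) = ?w x" for x m
      using cos_int_2pin[of "k * m"] sin_int_2pin[of "k * m"]
      by (simp add: distrib_left cos_add mult_ac)
    have wle: "\<bar>a * ?w x\<bar> \<le> b" if "\<bar>a\<bar> \<le> b" for a b x
      using mult_mono[OF that abs_cos_le_one[of "2 * pi * k * x"]] that by (simp add: abs_mult)
    have Fw: "F x * ?w x = (\<Sum>n. g n x * ?w x)" if "x \<in> ?J" for x
      unfolding F_def by (rule suminf_mult2[OF sumg[OF that]])
    have Gw: "G x * ?w x = (\<Sum>n. h n x * ?w x)" for x
      unfolding G_def by (rule suminf_mult2[OF sumh])
    have "(\<lambda>n. integral ?J (\<lambda>x. g n x * ?w x)) sums integral ?J (\<lambda>x. \<Sum>n. g n x * ?w x)"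
      by (rule integral_sums_dominated[OF _ wle[OF gbound] sg])
         (intro continuous_intros gcont | assumption)+
    also have "integral ?J (\<lambda>x. \<Sum>n. g n x * ?w x) = integral ?J (\<lambda>x. F x * ?w x)"
      by (rule integral_cong) (simp add: Fw)
    finally have "(\<lambda>N. \<Sum>n\<le>N. integral ?J (\<lambda>x. g n x * ?w x)) \<longlonglongrightarrow> integral ?J (\<lambda>x. F x * ?w x)"
      by (simp add: sums_def_le)
    moreover have "(\<Sum>n\<le>N. integral ?J (\<lambda>x. g n x * ?w x))
        = integral {-(real N + 1/2)..real N + 1/2} (\<lambda>x. f x * ?w x)" for N
      unfolding g_def by (rule integral_periodization) (use fcont[of _ 0] per in \<open>auto intro!: continuous_intros\<close>)
    moreover have "(\<lambda>N. integral {-(real N + 1/2)..real N + 1/2} (\<lambda>x. f x * ?w x))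
        \<longlonglongrightarrow> exp (- (2 * pi * k)\<^sup>2 / (4 * pi * t)) / sqrt t"
      unfolding f_def by (rule gaussian_cos_limit[OF t])
    moreover have "- (2 * pi * k)\<^sup>2 / (4 * pi * t) = - pi * (1 / t) * k\<^sup>2"
      using t by (simp add: power2_eq_square field_simps)
    ultimately show "integral ?J (\<lambda>x. F x * ?w x) = exp (- pi * (1 / t) * k\<^sup>2) / sqrt t"
      using LIMSEQ_unique by fastforce
    have "(\<lambda>n. integral ?J (\<lambda>x. h n x * ?w x)) sums integral ?J (\<lambda>x. \<Sum>n. h n x * ?w x)"
      by (rule integral_sums_dominated[OF _ wle[OF hbound] sh])
         (intro continuous_intros hcont)
    moreover have "integral ?J (\<lambda>x. h n x * ?w x)
        = (if n = nat \<bar>k\<bar> then exp (- pi * (1 / t) * (real n)\<^sup>2) / sqrt t else 0)" for n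
    proof -
      have "integral ?J (\<lambda>x. h n x * ?w x) = integral ?J (\<lambda>x. exp (- pi * (1 / t) * (real n)\<^sup>2) / sqrt t * (abs_multiplicity n * cos (2 * pi * n * x) * ?w x))"
        by (simp add: h_def mult_ac)
      thus ?thesis by (simp only: Henstock_Kurzweil_Integration.integral_mult_right cos_orthogonal) auto
    qed
    ultimately have "(\<lambda>n. if n = nat \<bar>k\<bar> then exp (- pi * (1 / t) * (real n)\<^sup>2) / sqrt t else 0)
        sums integral ?J (\<lambda>x. G x * ?w x)" by (simp add: Gw)
    from sums_unique2[OF this sums_single]
    show "integral ?J (\<lambda>x. G x * ?w x) = exp (- pi * (1 / t) * k\<^sup>2) / sqrt t" by simp
  qed
  have geven: "g n (- x) = g n x" for n x
    using power2_commute[of "real n" x] by (simp add: g_def f_def power2_eq_square algebra_simps)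
  have "F 0 - G 0 = 0"
  proof (rule vanishing_cos_coeffs_imp_zero[where H = "\<lambda>x. F x - G x"])
    show "continuous_on ?J (\<lambda>x. F x - G x)" by (intro continuous_intros Fcont Gcont)
    show "F (- x) - G (- x) = F x - G x" for x by (simp add: F_def G_def geven h_def)
    fix k :: int
    have "integral ?J (\<lambda>x. F x * cos (2 * pi * k * x) - G x * cos (2 * pi * k * x)) = 0"
      by (subst Henstock_Kurzweil_Integration.integral_diff)
         (auto intro!: integrable_continuous_interval continuous_intros Fcont Gcont simp: coeffs)
    thus "integral ?J (\<lambda>x. (F x - G x) * cos (2 * pi * k * x)) = 0" by (simp add: algebra_simps)
  qed auto
  moreover have "g n 0 = abs_multiplicity n * exp (- pi * t * (real n)\<^sup>2)" for n
    by (simp add: g_def abs_multiplicity_def f_def)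
  moreover have "G 0 = (\<Sum>n. abs_multiplicity n * exp (- pi * (1 / t) * (real n)\<^sup>2)) / sqrt t"
  proof -
    have hn: "h n 0 = abs_multiplicity n * exp (- pi * (1 / t) * (real n)\<^sup>2) / sqrt t" for n
      by (simp add: h_def)
    have "summable (\<lambda>n. h n 0 * sqrt t)" by (intro summable_mult2 sumh)
    hence "summable (\<lambda>n. abs_multiplicity n * exp (- pi * (1 / t) * (real n)\<^sup>2))" using t by (simp add: hn)
    thus ?thesis unfolding G_def hn by (rule suminf_divide)
  qed
  ultimately show ?thesis by (simp add: F_def)
qed

section \<open>Derivatives of the theta series\<close>

text \<open>
  The terms of the series of the \<open>k\<close>-th derivative of \<open>theta00\<close>, with \<open>n\<close> and \<open>- n\<close> taken together.
\<close>

definition theta_term :: "nat \<Rightarrow> nat \<Rightarrow> complex \<Rightarrow> complex" where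
  "theta_term k n \<tau> = of_real (abs_multiplicity n) * (\<i> * of_real pi * of_nat n ^ 2) ^ k * exp (\<i> * of_real pi * of_nat n ^ 2 * \<tau>)"

definition theta_deriv :: "nat \<Rightarrow> complex \<Rightarrow> complex" where
  "theta_deriv k \<tau> = (\<Sum>n. theta_term k n \<tau>)"

text \<open>
  The \<open>k\<close>-th derivative of \<open>\<psi>(x) = theta00 (\<i> x)\<close> as a function of the real variable \<open>x\<close>.
\<close>

definition real_theta :: "nat \<Rightarrow> real \<Rightarrow> real" where
  "real_theta k x = (\<Sum>n. abs_multiplicity n * (- pi * (real n)\<^sup>2) ^ k * exp (- pi * x * (real n)\<^sup>2))"

lemma power_le_fact_exp:
  fixes x :: real
  assumes "x \<ge> 0"
  shows "x ^ k \<le> fact k * exp x"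
proof -
  have "(\<Sum>n\<in>{k}. x ^ n / fact n) \<le> (\<Sum>n. x ^ n / fact n)"
    using assms summable_exp[of x] by (intro sum_le_suminf) (auto simp: field_simps)
  thus ?thesis by (simp add: exp_def field_simps scaleR_conv_of_real)
qed

text \<open>
  Half of the exponential decay absorbs the factor \<open>(\<pi> n\<^sup>2)^k\<close>, and the other half leaves a geometric
  majorant that is uniform in \<open>Im \<tau> \<ge> d\<close>, as termwise differentiation requires.
\<close>

lemma norm_theta_term_le:
  assumes d: "0 < d" "d \<le> Im \<tau>"
  shows "norm (theta_term k n \<tau>) \<le> 2 * (fact k * (2 / d) ^ k) * exp (- pi * d / 2) ^ n"
proof -
  define M where "M = pi * (real n)\<^sup>2"
  have M: "M \<ge> 0" by (simp add: M_def)
  have nle: "real n \<le> (real n)\<^sup>2" by (cases n) (auto simp: power2_eq_square)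
  have "norm (theta_term k n \<tau>) = abs_multiplicity n * M ^ k * exp (- M * Im \<tau>)"
    by (simp add: theta_term_def M_def norm_mult norm_power abs_multiplicity_def power2_eq_square)
  also have "\<dots> \<le> 2 * M ^ k * exp (- M * d)"
    using d M by (intro mult_mono) (auto simp: abs_multiplicity_def intro: mult_left_mono)
  also have "\<dots> = 2 * (((2 / d) ^ k * ((M * d / 2) ^ k * exp (- (M * d / 2)))) * exp (- M * d / 2))"
    using d by (simp add: power_mult_distrib power_divide exp_add[symmetric] field_simps)
  also have "\<dots> \<le> 2 * (((2 / d) ^ k * fact k) * exp (- pi * d / 2) ^ n)"
  proof (intro mult_left_mono mult_mono)
    show "(M * d / 2) ^ k * exp (- (M * d / 2)) \<le> fact k"
      using power_le_fact_exp[of "M * d / 2" k] M d by (simp add: exp_minus field_simps)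
    show "exp (- M * d / 2) \<le> exp (- pi * d / 2) ^ n"
      using d mult_right_mono[OF nle, of "pi * d"] by (simp add: M_def exp_of_nat_mult[symmetric] field_simps)
  qed (use d M in auto)
  finally show ?thesis by (simp add: mult_ac)
qed

lemma summable_theta_bound: "d > 0 \<Longrightarrow> summable (\<lambda>n. C * exp (- pi * d / 2) ^ n)" for C d :: real
  by (auto intro!: summable_mult summable_geometric)

lemma summable_norm_theta_term: "Im \<tau> > 0 \<Longrightarrow> summable (\<lambda>n. norm (theta_term k n \<tau>))"
  by (rule summable_comparison_test'[OF summable_theta_bound[of "Im \<tau>"]])
     (use norm_theta_term_le[of "Im \<tau>" \<tau> k] in auto)

lemma summable_theta_term: "Im \<tau> > 0 \<Longrightarrow> summable (\<lambda>n. theta_term k n \<tau>)"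
  by (rule summable_norm_cancel[OF summable_norm_theta_term])

lemma has_field_derivative_theta_deriv:
  assumes "Im \<tau> > 0"
  shows "(theta_deriv k has_field_derivative theta_deriv (Suc k) \<tau>) (at \<tau>)"
proof -
  let ?S = "{z. Im z > 0}"
  have "\<exists>g g'. \<forall>z\<in>?S. (\<lambda>n. theta_term k n z) sums g z \<and> (\<lambda>n. theta_term (Suc k) n z) sums g' z
      \<and> (g has_field_derivative g' z) (at z)"
  proof (rule series_and_derivative_comparison_complex)
    show "open ?S" by (rule open_halfspace_Im_gt)
    show "(theta_term k n has_field_derivative theta_term (Suc k) n z) (at z)" for n z
      unfolding theta_term_def by (auto intro!: derivative_eq_intros)
  next
    fix z assume z: "z \<in> ?S"
    define d where "d = Im z / 2"
    have d: "d > 0" using z by (simp add: d_def)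
    have dle: "d \<le> Im y" if "y \<in> ball z d" for y
      using that abs_Im_le_cmod[of "z - y"] by (simp add: dist_norm d_def)
    let ?h = "\<lambda>n. complex_of_real (2 * (fact k * (2 / d) ^ k) * exp (- pi * d / 2) ^ n)"
    show "\<exists>d h. 0 < d \<and> summable h \<and> range h \<subseteq> \<real>\<^sub>\<ge>\<^sub>0
        \<and> (\<forall>\<^sub>F n in sequentially. \<forall>y\<in>ball z d \<inter> ?S. norm (theta_term k n y) \<le> cmod (h n))"
    proof (rule exI[of _ d], rule exI[of _ ?h], intro conjI)
      show "summable ?h" by (rule summable_of_real[OF summable_theta_bound[OF d]])
      show "range ?h \<subseteq> \<real>\<^sub>\<ge>\<^sub>0" using d by (auto simp del: of_real_mult of_real_power)
      have "norm (theta_term k n y) \<le> norm (?h n)" if "y \<in> ball z d" for n y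
        using norm_theta_term_le[OF d dle[OF that], of k n] unfolding norm_of_real by linarith
      thus "\<forall>\<^sub>F n in sequentially. \<forall>y\<in>ball z d \<inter> ?S. norm (theta_term k n y) \<le> norm (?h n)"
        by (intro always_eventually allI ballI) (elim IntE)
    qed (rule d)
  qed
  then obtain g g' where g: "\<And>z. Im z > 0 \<Longrightarrow> (\<lambda>n. theta_term k n z) sums g z"
    "\<And>z. Im z > 0 \<Longrightarrow> (\<lambda>n. theta_term (Suc k) n z) sums g' z"
    "\<And>z. Im z > 0 \<Longrightarrow> (g has_field_derivative g' z) (at z)" by auto
  have "g' \<tau> = theta_deriv (Suc k) \<tau>"
    using sums_unique[OF g(2)[OF assms]] by (simp add: theta_deriv_def)
  moreover have "theta_deriv k z = g z" if "Im z > 0" for z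
    using sums_unique[OF g(1)[OF that]] by (simp add: theta_deriv_def)
  ultimately show ?thesis
    using has_field_derivative_transform_within_open[OF g(3)[OF assms] open_halfspace_Im_gt[of 0], of "theta_deriv k"] assms
    by auto
qed

lemma theta00_eq_theta_deriv:
  assumes "Im \<tau> > 0"
  shows "theta00 \<tau> = theta_deriv 0 \<tau>"
proof -
  define f where "f = (\<lambda>n::int. exp (\<i> * of_real pi * of_int n ^ 2 * \<tau>))"
  have f_eq: "theta_term 0 n \<tau> = of_real (abs_multiplicity n) * f (int n)" for n
    by (simp add: theta_term_def f_def)
  have fneg: "f (- n) = f n" for n by (simp add: f_def)
  have sN: "summable (\<lambda>n. norm (f (int n)))"
    by (rule summable_comparison_test'[OF summable_norm_theta_term[OF assms, of 0], of 0])
       (simp add: f_eq norm_mult abs_multiplicity_def)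
  define S where "S = (\<Sum>n. f (int n))"
  have s: "(\<lambda>n. f (int n)) sums S"
    unfolding S_def by (rule summable_sums[OF summable_norm_cancel[OF sN]])
  \<comment> \<open>The negative integers contribute the same sum as the positive ones, that is, all but \<open>n = 0\<close>.\<close>
  have s': "(\<lambda>n. f (- int (Suc n))) sums (S - f 0)"
    using s sums_Suc_iff[of "\<lambda>n. f (int n)" "S - f 0"] by (simp only: fneg) simp
  have "((\<lambda>n. f (int n)) has_sum S) UNIV"
    by (rule norm_summable_imp_has_sum[OF sN s])
  hence h1: "(f has_sum S) (range int)"
    by (subst has_sum_reindex) (auto simp: o_def)
  have sN': "summable (\<lambda>n. norm (f (- int (Suc n))))"
    using sN by (simp only: fneg summable_Suc_iff[of "\<lambda>n. norm (f (int n))"])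
  have "((\<lambda>n. f (- int (Suc n))) has_sum (S - f 0)) UNIV"
    by (rule norm_summable_imp_has_sum[OF sN' s'])
  hence h2: "(f has_sum (S - f 0)) (range (\<lambda>n. - int (Suc n)))"
    by (subst has_sum_reindex) (auto simp: o_def inj_on_def)
  have "range int \<inter> range (\<lambda>n. - int (Suc n)) = {}" by auto
  from has_sum_Un_disjoint[OF h1 h2 this]
  have "(f has_sum (S + (S - f 0))) (range int \<union> range (\<lambda>n. - int (Suc n)))" .
  moreover have "range int \<union> range (\<lambda>n. - int (Suc n)) = UNIV"
  proof -
    have "x \<in> range int \<union> range (\<lambda>n. - int (Suc n))" for x
      by (cases x rule: int_cases) auto
    thus ?thesis by blast
  qed
  ultimately have "theta00 \<tau> = 2 * S - f 0"
    by (simp add: theta00_def f_def[symmetric] infsumI)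
  moreover have "(\<lambda>n. 2 * f (int n) - (if n = 0 then f 0 else 0)) sums (2 * S - f 0)"
    using sums_single[of 0 "\<lambda>_. f 0"] by (intro sums_diff sums_mult s) auto
  moreover have "2 * f (int n) - (if n = 0 then f 0 else 0) = theta_term 0 n \<tau>" for n
    by (simp add: f_eq abs_multiplicity_def)
  ultimately show ?thesis by (simp add: theta_deriv_def sums_iff)
qed

lemma has_field_derivative_theta00:
  "Im \<tau> > 0 \<Longrightarrow> (theta00 has_field_derivative theta_deriv 1 \<tau>) (at \<tau>)"
  using has_field_derivative_transform_within_open[OF has_field_derivative_theta_deriv[of \<tau> 0]
      open_halfspace_Im_gt[of 0], of theta00]
  by (auto simp: theta00_eq_theta_deriv)

lemma deriv_theta00: "Im \<tau> > 0 \<Longrightarrow> deriv theta00 \<tau> = theta_deriv 1 \<tau>"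
  by (rule DERIV_imp_deriv[OF has_field_derivative_theta00])

lemma deriv_deriv_theta00: 
  assumes "Im \<tau> > 0" shows "deriv (deriv theta00) \<tau> = theta_deriv 2 \<tau>"
  using has_field_derivative_transform_within_open[OF has_field_derivative_theta_deriv[OF assms, of 1]
      open_halfspace_Im_gt[of 0], of "deriv theta00"] assms
  by (auto simp: deriv_theta00 numeral_2_eq_2 intro: DERIV_imp_deriv)

lemma real_theta_eq:
  assumes "x > 0"
  shows "complex_of_real (real_theta k x) = \<i> ^ k * theta_deriv k (\<i> * x)"
    and "summable (\<lambda>n. abs_multiplicity n * (- pi * (real n)\<^sup>2) ^ k * exp (- pi * x * (real n)\<^sup>2))"
proof -
  have pow: "\<i> ^ k * (\<i> * of_real pi * of_nat n ^ 2) ^ k = (complex_of_real (- pi * (real n)\<^sup>2)) ^ k" for n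
    by (simp flip: power_mult_distrib) (simp add: mult.assoc[symmetric])
  have ex: "exp (\<i> * of_real pi * of_nat n ^ 2 * (\<i> * x)) = complex_of_real (exp (- pi * x * (real n)\<^sup>2))" for n
    by (simp add: exp_of_real[symmetric] mult_ac)
  have eq: "\<i> ^ k * theta_term k n (\<i> * x) = complex_of_real (abs_multiplicity n * (- pi * (real n)\<^sup>2) ^ k * exp (- pi * x * (real n)\<^sup>2))" for n
  proof -
    have "\<i> ^ k * theta_term k n (\<i> * x) = of_real (abs_multiplicity n) * (\<i> ^ k * (\<i> * of_real pi * of_nat n ^ 2) ^ k)
        * exp (\<i> * of_real pi * of_nat n ^ 2 * (\<i> * x))"
      by (simp add: theta_term_def)
    thus ?thesis by (simp only: pow ex of_real_mult of_real_power)
  qed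
  have s: "summable (\<lambda>n. \<i> ^ k * theta_term k n (\<i> * x))"
    by (intro summable_mult summable_theta_term) (use assms in simp)
  thus s': "summable (\<lambda>n. abs_multiplicity n * (- pi * (real n)\<^sup>2) ^ k * exp (- pi * x * (real n)\<^sup>2))"
    unfolding eq by (simp only: summable_of_real_iff)
  show "complex_of_real (real_theta k x) = \<i> ^ k * theta_deriv k (\<i> * x)"
    unfolding real_theta_def theta_deriv_def suminf_of_real[OF s'] eq[symmetric]
    by (rule suminf_mult) (use assms summable_theta_term in simp)
qed

lemma has_real_derivative_real_theta:
  assumes "x > 0"
  shows "(real_theta k has_real_derivative real_theta (Suc k) x) (at x)"
proof -
  have "((\<lambda>z. \<i> ^ k * theta_deriv k (\<i> * z)) has_field_derivative complex_of_real (real_theta (Suc k) x)) (at (of_real x))"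
    unfolding real_theta_eq[OF assms]
    by (rule DERIV_cong, rule DERIV_cmult, rule DERIV_chain2[where g = "\<lambda>z. \<i> * z", OF has_field_derivative_theta_deriv])
       (use assms in \<open>auto intro!: derivative_eq_intros\<close>)
  from has_vector_derivative_real_field[OF this]
  have "((\<lambda>y. \<i> ^ k * theta_deriv k (\<i> * of_real y)) has_vector_derivative complex_of_real (real_theta (Suc k) x)) (at x)" .
  from bounded_linear.has_vector_derivative[OF bounded_linear_Re this]
  have "((\<lambda>y. Re (\<i> ^ k * theta_deriv k (\<i> * of_real y))) has_real_derivative real_theta (Suc k) x) (at x)"
    by (simp add: has_real_derivative_iff_has_vector_derivative)
  thus ?thesis
    by (rule has_field_derivative_transform_within_open[where S = "{0<..}"])
       (use assms in \<open>auto simp flip: real_theta_eq\<close>)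
qed

section \<open>Positivity on the imaginary axis\<close>

text \<open>
  With \<open>\<delta> = x d/dx\<close> this is \<open>\<delta> (\<delta> + 1/2) \<psi>\<close>, the second factor of \<open>Theta00\<close> on the imaginary axis.
\<close>

definition theta_form :: "real \<Rightarrow> real" where
  "theta_form x = x\<^sup>2 * real_theta 2 x + 3/2 * x * real_theta 1 x"

text \<open>
  Conjugation by \<open>sqrt x\<close> turns \<open>\<delta>\<close> into \<open>\<delta> - 1/2\<close>, and \<open>x \<mapsto> 1/x\<close> turns \<open>\<delta>\<close> into \<open>- \<delta>\<close>. Together they
  exchange the two factors of \<open>\<delta> (\<delta> + 1/2)\<close>, up to signs that cancel, so that the operator commutes
  with the transformation of \<open>\<psi>\<close>. The proof applies \<open>\<delta>\<close> once (\<open>E1\<close>) and then once more.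
\<close>

lemma theta_form_modular:
  assumes x: "x > 0"
  shows "sqrt x * theta_form x = theta_form (1 / x)"
proof -
  let ?R = real_theta
  note D = has_real_derivative_real_theta
  have D0: "(?R 0 has_real_derivative ?R 1 y) (at y)" and D1: "(?R 1 has_real_derivative ?R 2 y) (at y)"
    if "y > 0" for y
    using D[OF that, of 0] D[OF that, of 1] by (simp_all add: numeral_2_eq_2)
  have E0: "sqrt y * ?R 0 y = ?R 0 (1 / y)" if "y > 0" for y
    using theta_transformation[OF that] that by (simp add: real_theta_def)
  have E1: "sqrt y * (y * ?R 1 y + ?R 0 y / 2) = - (?R 1 (1 / y) / y)" if y: "y > 0" for y
  proof -
    have "((\<lambda>y. sqrt y * ?R 0 y) has_real_derivative (sqrt y * ?R 1 y + ?R 0 y / (2 * sqrt y))) (at y)"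
      using y by (auto intro!: derivative_eq_intros D0 simp: field_simps)
    moreover have "((\<lambda>y. ?R 0 (1 / y)) has_real_derivative (- (?R 1 (1 / y) / y\<^sup>2))) (at y)"
    proof -
      have "((\<lambda>y. ?R 0 (1 / y)) has_real_derivative ?R 1 (1 / y) * (- 1 / y\<^sup>2)) (at y)"
        by (rule DERIV_chain2[where f = "?R 0", OF D0])
           (use y in \<open>auto intro!: derivative_eq_intros simp: power2_eq_square\<close>)
      thus ?thesis by simp
    qed
    hence "((\<lambda>y. sqrt y * ?R 0 y) has_real_derivative (- (?R 1 (1 / y) / y\<^sup>2))) (at y)"
      by (rule has_field_derivative_transform_within_open[where S = "{0<..}"]) (use y E0 in auto)
    ultimately have "sqrt y * ?R 1 y + ?R 0 y / (2 * sqrt y) = - (?R 1 (1 / y) / y\<^sup>2)"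
      by (rule DERIV_unique)
    hence "y * (sqrt y * ?R 1 y + ?R 0 y / (2 * sqrt y)) = y * (- (?R 1 (1 / y) / y\<^sup>2))" by simp
    moreover have "y * (?R 0 y / (2 * sqrt y)) = sqrt y * ?R 0 y / 2"
      using y real_div_sqrt[of y] by (simp add: field_simps)
    moreover have "y * (- (?R 1 (1 / y) / y\<^sup>2)) = - (?R 1 (1 / y) / y)"
      using y by (simp add: power2_eq_square)
    ultimately have "y * (sqrt y * ?R 1 y) + sqrt y * ?R 0 y / 2 = - (?R 1 (1 / y) / y)"
      by (simp only: distrib_left)
    thus ?thesis by (simp add: distrib_left mult_ac)
  qed
  define P where "P = (\<lambda>y. y * ?R 1 y + ?R 0 y / 2)"
  have "(P has_real_derivative (x * ?R 2 x + 3/2 * ?R 1 x)) (at x)"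
    unfolding P_def using x by (auto intro!: derivative_eq_intros D0 D1[unfolded One_nat_def])
  hence "((\<lambda>y. sqrt y * P y) has_real_derivative (sqrt x * (x * ?R 2 x + 3/2 * ?R 1 x) + P x / (2 * sqrt x))) (at x)"
    using x by (auto intro!: derivative_eq_intros simp: field_simps)
  moreover have "((\<lambda>y. - (?R 1 (1 / y) / y)) has_real_derivative (?R 2 (1 / x) / x ^ 3 + ?R 1 (1 / x) / x\<^sup>2)) (at x)"
  proof -
    have "((\<lambda>y. ?R 1 (1 / y)) has_real_derivative ?R 2 (1 / x) * (- 1 / x\<^sup>2)) (at x)"
      by (rule DERIV_chain2[where f = "?R 1", OF D1])
         (use x in \<open>auto intro!: derivative_eq_intros simp: power2_eq_square\<close>)
    from DERIV_minus[OF DERIV_divide[OF this DERIV_ident]] show ?thesis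
      using x by (rule_tac DERIV_cong) (auto simp: power2_eq_square power3_eq_cube field_simps)
  qed
  hence "((\<lambda>y. sqrt y * P y) has_real_derivative (?R 2 (1 / x) / x ^ 3 + ?R 1 (1 / x) / x\<^sup>2)) (at x)"
    by (rule has_field_derivative_transform_within_open[where S = "{0<..}"]) (use x E1 in \<open>auto simp: P_def\<close>)
  ultimately have "sqrt x * (x * ?R 2 x + 3/2 * ?R 1 x) + P x / (2 * sqrt x) = ?R 2 (1 / x) / x ^ 3 + ?R 1 (1 / x) / x\<^sup>2"
    by (rule DERIV_unique)
  hence "x * (sqrt x * (x * ?R 2 x + 3/2 * ?R 1 x) + P x / (2 * sqrt x)) = x * (?R 2 (1 / x) / x ^ 3 + ?R 1 (1 / x) / x\<^sup>2)"
    by simp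
  moreover have "x * (P x / (2 * sqrt x)) = sqrt x * P x / 2"
    using x real_div_sqrt[of x] by (simp add: field_simps)
  moreover have "sqrt x * P x = - (?R 1 (1 / x) / x)" using E1[OF x] by (simp add: P_def)
  moreover have "x * (sqrt x * (x * ?R 2 x + 3/2 * ?R 1 x)) = sqrt x * theta_form x"
    by (simp add: theta_form_def power2_eq_square algebra_simps)
  ultimately have "sqrt x * theta_form x - ?R 1 (1 / x) / x / 2 = x * (?R 2 (1 / x) / x ^ 3 + ?R 1 (1 / x) / x\<^sup>2)"
    by (simp only: distrib_left)
  moreover have "x * (?R 2 (1 / x) / x ^ 3 + ?R 1 (1 / x) / x\<^sup>2) = (1 / x)\<^sup>2 * ?R 2 (1 / x) + 1 / x * ?R 1 (1 / x)"
    using x by (simp add: distrib_left power2_eq_square power3_eq_cube)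
  moreover have "theta_form (1 / x) = (1 / x)\<^sup>2 * ?R 2 (1 / x) + 3/2 * (1 / x) * ?R 1 (1 / x)"
    by (simp only: theta_form_def)
  ultimately show ?thesis by simp
qed

text \<open>
  For \<open>y \<ge> 1\<close> and \<open>n \<ge> 1\<close> the \<open>n\<close>-th term has the sign of \<open>\<pi> y n\<^sup>2 - 3/2 > 0\<close>; smaller arguments are reflected to
  larger ones.
\<close>

lemma theta_form_pos:
  assumes x: "x > 0"
  shows "theta_form x > 0"
proof -
  have pos: "theta_form y > 0" if y: "y \<ge> 1" for y
  proof -
    let ?a = "\<lambda>k n. abs_multiplicity n * (- pi * (real n)\<^sup>2) ^ k * exp (- pi * y * (real n)\<^sup>2)"
    let ?b = "\<lambda>n. abs_multiplicity n * (pi * y * (real n)\<^sup>2) * (pi * y * (real n)\<^sup>2 - 3/2) * exp (- pi * y * (real n)\<^sup>2)"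
    have s: "summable (?a k)" for k using real_theta_eq(2)[of y k] y by simp
    have b: "?b = (\<lambda>n. y\<^sup>2 * ?a 2 n + 3/2 * y * ?a 1 n)"
      by (rule ext) (simp add: power2_eq_square algebra_simps)
    have sums: "?b sums theta_form y"
      unfolding b theta_form_def real_theta_def
      by (intro sums_add sums_mult summable_sums s)
    have nonneg: "?b n \<ge> 0" and pos1: "n > 0 \<Longrightarrow> ?b n > 0" for n
    proof -
      show pos: "?b n > 0" if "n > 0" for n
      proof -
        have "pi * y * (real n)\<^sup>2 \<ge> 3 * 1 * 1"
          using pi_gt3 y that by (intro mult_mono) auto
        thus ?thesis using y that by (auto simp: abs_multiplicity_def)
      qed
      show "?b n \<ge> 0" using pos[of n] by (cases "n = 0") auto
    qed
    have "suminf ?b > 0"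
      by (rule suminf_pos2[of _ 1]) (use sums nonneg pos1[of 1] in \<open>auto simp: sums_iff\<close>)
    thus ?thesis using sums by (simp add: sums_iff)
  qed
  show ?thesis
  proof (cases "x \<ge> 1")
    case False
    hence "sqrt x * theta_form x > 0"
      using pos[of "1 / x"] theta_form_modular[OF x] x by simp
    thus ?thesis using x by (simp add: zero_less_mult_iff)
  qed (use pos in simp)
qed

lemma Theta00_eq:
  assumes "Im \<tau> > 0"
  shows "Theta00 \<tau> = (\<tau> / \<i>) powr (1/4) * (\<tau> ^ 2 * theta_deriv 2 \<tau> + 3/2 * \<tau> * theta_deriv 1 \<tau>)"
  using assms by (simp add: Theta00_def deriv_theta00 deriv_deriv_theta00)

lemma Theta00_imaginary_axis:
  assumes "t > 0"
  shows "Theta00 (\<i> * of_real t ^ 2) = of_real (t\<^sup>2 powr (1/4) * theta_form (t\<^sup>2))"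
proof -
  define x where "x = t\<^sup>2"
  have x: "x > 0" using assms by (simp add: x_def)
  have \<tau>: "\<i> * of_real t ^ 2 = \<i> * complex_of_real x" by (simp add: x_def)
  have "(\<i> * x / \<i>) powr (1/4) = complex_of_real (x powr (1/4))"
    using x powr_of_real[of x "1/4"] by simp
  moreover have "(\<i> * x)\<^sup>2 * theta_deriv 2 (\<i> * x) + 3/2 * (\<i> * x) * theta_deriv 1 (\<i> * x) = of_real (theta_form x)"
    using real_theta_eq(1)[OF x, of 1] real_theta_eq(1)[OF x, of 2]
    by (simp add: theta_form_def power_mult_distrib)
  ultimately show ?thesis
    unfolding \<tau> x_def[symmetric] using x by (simp add: Theta00_eq)
qed

lemma Theta00_has_field_derivative:
  assumes "Im \<tau> > 0"
  shows "\<exists>D. (Theta00 has_field_derivative D) (at \<tau>)"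
proof -
  let ?F = "\<lambda>\<tau>. (\<tau> / \<i>) powr (1/4) * (\<tau> ^ 2 * theta_deriv 2 \<tau> + 3/2 * \<tau> * theta_deriv 1 \<tau>)"
  have "Re (\<tau> / \<i>) > 0" using assms by simp
  hence nn: "\<tau> / \<i> \<notin> \<real>\<^sub>\<le>\<^sub>0" by (auto simp: complex_nonpos_Reals_iff)
  have "?F field_differentiable (at \<tau>)"
  proof (intro derivative_intros)
    have "((\<lambda>\<tau>. (\<tau> / \<i>) powr (1/4)) has_field_derivative (1/4 * (\<tau> / \<i>) powr (1/4 - 1) * (1 / \<i>))) (at \<tau>)"
      by (rule DERIV_chain2[where g = "\<lambda>\<tau>. \<tau> / \<i>", OF has_field_derivative_powr[OF nn]])
         (auto intro!: derivative_eq_intros)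
    thus "(\<lambda>\<tau>. (\<tau> / \<i>) powr (1/4)) field_differentiable (at \<tau>)"
      by (auto simp: field_differentiable_def)
  qed (use has_field_derivative_theta_deriv[OF assms] in \<open>auto simp: field_differentiable_def\<close>)
  then obtain D where "(?F has_field_derivative D) (at \<tau>)" by (auto simp: field_differentiable_def)
  from has_field_derivative_transform_within_open[OF this open_halfspace_Im_gt[of 0], of Theta00]
  show ?thesis using assms Theta00_eq by auto
qed

section \<open>The eigenvalue equation\<close>

definition Theta00_axis :: "real \<Rightarrow> complex" where
  "Theta00_axis t = (if t > 0 then Theta00 (\<i> * of_real t ^ 2) else 0)"

lemma Theta00_axis_differentiable:
  assumes "t > 0"
  obtains D where "(Theta00_axis has_vector_derivative D) (at t)"
proof -
  obtain D where D: "(Theta00 has_field_derivative D) (at (\<i> * of_real t ^ 2))"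
    using Theta00_has_field_derivative[of "\<i> * of_real t ^ 2"] assms by auto
  have "((\<lambda>z. Theta00 (\<i> * z ^ 2)) has_field_derivative D * (\<i> * (2 * of_real t))) (at (of_real t))"
    by (rule DERIV_chain2[where g = "\<lambda>z. \<i> * z ^ 2", OF D]) (auto intro!: derivative_eq_intros)
  from has_vector_derivative_real_field[OF this]
  have "((\<lambda>t. Theta00 (\<i> * of_real t ^ 2)) has_vector_derivative D * (\<i> * (2 * of_real t))) (at t)" .
  hence "(Theta00_axis has_vector_derivative D * (\<i> * (2 * of_real t))) (at t)"
    by (rule has_vector_derivative_transform_within_open[where S = "{0<..}"])
       (use assms in \<open>auto simp: Theta00_axis_def\<close>)
  thus ?thesis by (rule that)
qed

lemma Theta00_axis_not_nonpos: 
  assumes "t > 0" 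
  shows "Theta00_axis t \<notin> \<real>\<^sub>\<le>\<^sub>0"
proof -
  have "t\<^sup>2 powr (1/4) * theta_form (t\<^sup>2) > 0"
    using theta_form_pos[of "t\<^sup>2"] assms by (intro mult_pos_pos) auto
  thus ?thesis
    using assms by (simp only: Theta00_axis_def Theta00_imaginary_axis if_True nonpos_Reals_of_real_iff not_le)
qed

text \<open>
  \<open>L_op phi00\<close> is \<open>D_times\<close> conjugated by \<open>exp (- phi00)\<close>, which is \<open>\<Theta>\<close>; so it kills \<open>\<Theta>\<close> wherever \<open>\<Theta>\<close>
  avoids the branch cut of the logarithm.
\<close>

lemma L_op_Theta00_axis: "L_op phi00 Theta00_axis t = 0"
proof (cases "t > 0")
  case t: True
  obtain D where D: "(Theta00_axis has_vector_derivative D) (at t)"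
    by (rule Theta00_axis_differentiable[OF t])
  have nz: "Theta00_axis t \<noteq> 0" using Theta00_axis_not_nonpos[OF t] by auto
  have "((\<lambda>t. - Ln (Theta00_axis t)) has_vector_derivative - (D * (1 / Theta00_axis t))) (at t)"
    using field_vector_diff_chain_at[OF D has_field_derivative_Ln[OF Theta00_axis_not_nonpos[OF t]]]
    by (intro has_vector_derivative_minus) (simp add: o_def field_simps)
  hence "(phi00 has_vector_derivative - (D * (1 / Theta00_axis t))) (at t)"
    by (rule has_vector_derivative_transform_within_open[where S = "{0<..}"])
       (use t in \<open>auto simp: phi00_def Theta00_axis_def\<close>)
  thus ?thesis
    using t nz D by (simp add: L_op_def D_times_def vector_derivative_at)
qed (simp add: L_op_def D_times_def Theta00_axis_def)

lemma L_op_linear_combination: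
  assumes "\<And>t. t > 0 \<Longrightarrow> f differentiable (at t)" "\<And>t. t > 0 \<Longrightarrow> g differentiable (at t)"
  shows "L_op \<phi> (\<lambda>t. a * f t + b * g t) = (\<lambda>t. a * L_op \<phi> f t + b * L_op \<phi> g t)"
proof
  fix t :: real
  show "L_op \<phi> (\<lambda>t. a * f t + b * g t) t = a * L_op \<phi> f t + b * L_op \<phi> g t"
  proof (cases "t > 0")
    case t: True
    have "((\<lambda>t. a * f t + b * g t) has_vector_derivative
            (a * vector_derivative f (at t) + b * vector_derivative g (at t))) (at t)"
      using assms[OF t] by (intro derivative_intros) (auto simp: vector_derivative_works)
    thus ?thesis using t by (simp add: L_op_def D_times_def vector_derivative_at algebra_simps)
  qed (simp add: L_op_def D_times_def algebra_simps)
qed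

text \<open>
  The integrand is continuous on the open half-line, so convergence of the integral is decided near \<open>0\<close>
  alone: it converges for every upper limit or for none. If it diverges, the integral
  has the value \<open>0\<close> by convention; if it converges, \<open>u = u_fun \<alpha>\<close> solves \<open>t u' = \<Theta> - \<i> \<alpha> u\<close>.
\<close>

lemma u_fun_cases:
  obtains "u_fun \<alpha> = (\<lambda>t. 0)"
  | "\<And>t. t > 0 \<Longrightarrow> (u_fun \<alpha> has_vector_derivative (Theta00_axis t - \<i> * \<alpha> * u_fun \<alpha> t) / of_real t) (at t)"
proof -
  define F where "F = (\<lambda>y. of_real y powr (\<i> * \<alpha>) * Theta00_axis y / of_real y)"
  have F0: "integral {0<..t} (\<lambda>y. of_real y powr (\<i> * \<alpha>) * Theta00 (\<i> * of_real y ^ 2) / of_real y) = integral {0..t} F" for t :: real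
  proof -
    have "integral {0<..t} (\<lambda>y. of_real y powr (\<i> * \<alpha>) * Theta00 (\<i> * of_real y ^ 2) / of_real y) = integral {0<..t} F"
      by (rule integral_cong) (simp add: F_def Theta00_axis_def)
    also have "\<dots> = integral {0..t} F"
      by (rule integral_spike_set; rule negligible_subset[OF negligible_sing[of 0]]; force)
    finally show ?thesis .
  qed
  have u: "u_fun \<alpha> t = of_real t powr (- \<i> * \<alpha>) * integral {0..t} F" if "t > 0" for t
    unfolding u_fun_def F0 using that by simp
  have powr_deriv: "((\<lambda>t. complex_of_real t powr c) has_vector_derivative c * of_real t powr c / of_real t) (at t)"
    if "t > 0" for t c
  proof -
    have "((\<lambda>z. z powr c) has_field_derivative c * of_real t powr (c - 1)) (at (complex_of_real t))"
      using that by (intro has_field_derivative_powr) (simp add: complex_nonpos_Reals_iff)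
    moreover have "of_real t powr (c - 1) = of_real t powr c / complex_of_real t"
      using that by (simp add: powr_diff)
    ultimately have "((\<lambda>z. z powr c) has_field_derivative c * of_real t powr c / of_real t) (at (complex_of_real t))"
      by simp
    thus ?thesis by (rule has_vector_derivative_real_field)
  qed
  have Fcont: "isCont F t" if "t > 0" for t
  proof -
    obtain D where "(Theta00_axis has_vector_derivative D) (at t)"
      by (rule Theta00_axis_differentiable[OF \<open>t > 0\<close>])
    hence "isCont Theta00_axis t" by (rule has_vector_derivative_continuous)
    moreover have "isCont (\<lambda>y. complex_of_real y powr (\<i> * \<alpha>)) t"
      by (rule has_vector_derivative_continuous[OF powr_deriv[OF that]])
    ultimately show ?thesis using that unfolding F_def by (intro continuous_intros) auto
  qed
  have Fint: "F integrable_on {a..b}" if "a > 0" for a b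
    by (intro integrable_continuous_interval continuous_at_imp_continuous_on) (use that Fcont in auto)
  show ?thesis
  proof (cases "\<exists>t>0. F integrable_on {0..t}")
    case False
    have "u_fun \<alpha> t = 0" for t
    proof (cases "t > 0")
      case True
      hence "integral {0..t} F = 0" using False by (intro not_integrable_integral) blast
      thus ?thesis using u[OF True] by simp
    qed (simp add: u_fun_def)
    hence "u_fun \<alpha> = (\<lambda>t. 0)" by blast
    thus ?thesis by (rule that(1))
  next
    case True
    then obtain s where s: "s > 0" "F integrable_on {0..s}" by blast
    have int: "F integrable_on {0..b}" for b
    proof (cases "s \<le> b")
      case True
      thus ?thesis using Henstock_Kurzweil_Integration.integrable_combine[of 0 s b F] s Fint[of s b] by simp
    next
      case False
      thus ?thesis by (intro integrable_on_subinterval[OF s(2)]) auto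
    qed
    have "(u_fun \<alpha> has_vector_derivative (Theta00_axis t - \<i> * \<alpha> * u_fun \<alpha> t) / of_real t) (at t)" if t: "t > 0" for t
    proof -
      have "((\<lambda>u. integral {0..u} F) has_vector_derivative F t) (at t within ({0..t+1} - {}))"
        by (rule integral_has_vector_derivative_continuous_at[OF int])
           (use t Fcont[OF t] in \<open>auto intro: continuous_at_imp_continuous_at_within\<close>)
      hence I: "((\<lambda>u. integral {0..u} F) has_vector_derivative F t) (at t)"
        using t by (subst (asm) at_within_interior) auto
      have "((\<lambda>t. of_real t powr (- \<i> * \<alpha>) * integral {0..t} F) has_vector_derivative
              (of_real t powr (- \<i> * \<alpha>) * F t + (- \<i> * \<alpha>) * of_real t powr (- \<i> * \<alpha>) / of_real t * integral {0..t} F)) (at t)"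
        by (rule has_vector_derivative_mult[OF powr_deriv[OF t] I])
      moreover have "of_real t powr (- \<i> * \<alpha>) * F t = Theta00_axis t / of_real t"
        using t by (simp add: F_def powr_minus field_simps)
      moreover have "(- \<i> * \<alpha>) * of_real t powr (- \<i> * \<alpha>) / of_real t * integral {0..t} F = - (\<i> * \<alpha> * u_fun \<alpha> t) / of_real t"
        using u[OF t] by (simp add: mult_ac)
      ultimately have "((\<lambda>t. of_real t powr (- \<i> * \<alpha>) * integral {0..t} F) has_vector_derivative
          (Theta00_axis t - \<i> * \<alpha> * u_fun \<alpha> t) / of_real t) (at t)"
        by (simp only: diff_divide_distrib minus_divide_left[symmetric] add_uminus_conv_diff)
      thus ?thesis
        by (rule has_vector_derivative_transform_within_open[where S = "{0<..}"]) (use t u in auto)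
    qed
    thus ?thesis by (rule that(2))
  qed
qed

lemma L_op_D_times_u_fun:
  "L_op phi00 (D_times (u_fun \<alpha>)) = fscale (- \<alpha>) (L_op phi00 (u_fun \<alpha>))"
proof (cases rule: u_fun_cases[of \<alpha>])
  case 1
  have "D_times (\<lambda>t. 0) = (\<lambda>t. 0)" by (simp add: D_times_def fun_eq_iff)
  moreover have "L_op phi00 (\<lambda>t. 0) = (\<lambda>t. 0)"
    by (rule ext) (simp add: L_op_def calculation)
  ultimately show ?thesis by (simp add: 1 fscale_def)
next
  case 2
  have Du: "D_times (u_fun \<alpha>) = (\<lambda>t. (- \<alpha>) * u_fun \<alpha> t + (- \<i>) * Theta00_axis t)"
  proof
    fix t :: real
    show "D_times (u_fun \<alpha>) t = (- \<alpha>) * u_fun \<alpha> t + (- \<i>) * Theta00_axis t"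
    proof (cases "t > 0")
      case True
      show ?thesis
        using True by (simp add: D_times_def vector_derivative_at[OF 2[OF True]] field_simps)
    qed (simp add: D_times_def u_fun_def Theta00_axis_def)
  qed
  have "u_fun \<alpha> differentiable (at t)" "Theta00_axis differentiable (at t)" if "t > 0" for t
    using 2[OF that] Theta00_axis_differentiable[OF that] differentiableI_vector by blast+
  hence "L_op phi00 (D_times (u_fun \<alpha>)) =
      (\<lambda>t. (- \<alpha>) * L_op phi00 (u_fun \<alpha>) t + (- \<i>) * L_op phi00 Theta00_axis t)"
    unfolding Du by (rule L_op_linear_combination)
  thus ?thesis by (simp add: L_op_Theta00_axis fscale_def)
qed

lemma eigenfunctions_orthogonal:
  assumes "sesquilinear_on V B" and "x \<in> V" "y \<in> V"
    and "B (fscale a x) y = B x (fscale b y)" and "a \<noteq> cnj b"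
  shows "B x y = 0"
  using assms by (auto simp: sesquilinear_on_def)

theorem theorem4p2p2:
  fixes V :: "(real \<Rightarrow> complex) set"
    and B1 B2 :: "(real \<Rightarrow> complex) \<Rightarrow> (real \<Rightarrow> complex) \<Rightarrow> complex"
  assumes "V \<subseteq> pos_functions" and "cfun.subspace V"
    and "\<And>u. u \<in> H_finite \<Longrightarrow> L_op phi00 u \<in> V"
    and "\<And>u. u \<in> H_finite \<Longrightarrow> L_op phi00 (D_times u) \<in> V"
    and "sesquilinear_on V B2"
    and "connected_forms B1 B2"
    and "self_adjoint_pair B2"
  shows "(\<forall>\<alpha>::complex. \<alpha> \<notin> \<real> \<and> Xi \<alpha> = 0 \<longrightarrow>
            B1 (u_fun \<alpha>) (u_fun \<alpha>) = B2 (L_op phi00 (u_fun \<alpha>)) (L_op phi00 (u_fun \<alpha>)) \<and>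
            B2 (L_op phi00 (u_fun \<alpha>)) (L_op phi00 (u_fun \<alpha>)) = 0) \<and>
         (\<forall>\<alpha> \<beta>::real. \<alpha> \<noteq> \<beta> \<and> Xi (of_real \<alpha>) = 0 \<and> Xi (of_real \<beta>) = 0 \<longrightarrow>
            B1 (u_fun (of_real \<alpha>)) (u_fun (of_real \<beta>)) =
              B2 (L_op phi00 (u_fun (of_real \<alpha>))) (L_op phi00 (u_fun (of_real \<beta>))) \<and>
            B2 (L_op phi00 (u_fun (of_real \<alpha>))) (L_op phi00 (u_fun (of_real \<beta>))) = 0)"
proof -
  have mem: "u_fun \<alpha> \<in> H_finite" if "Xi \<alpha> = 0" for \<alpha>
    unfolding H_finite_def using that by (intro cfun.span_base) blast
  have B1: "B1 (u_fun \<alpha>) (u_fun \<beta>) = B2 (L_op phi00 (u_fun \<alpha>)) (L_op phi00 (u_fun \<beta>))"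
    if "Xi \<alpha> = 0" "Xi \<beta> = 0" for \<alpha> \<beta>
    using assms(6) mem that by (auto simp: connected_forms_def)
  have orth: "B2 (L_op phi00 (u_fun \<alpha>)) (L_op phi00 (u_fun \<beta>)) = 0"
    if "Xi \<alpha> = 0" "Xi \<beta> = 0" "\<alpha> \<noteq> cnj \<beta>" for \<alpha> \<beta>
  proof (rule eigenfunctions_orthogonal[OF assms(5)])
    show "L_op phi00 (u_fun \<alpha>) \<in> V" "L_op phi00 (u_fun \<beta>) \<in> V"
      using assms(3) mem that by auto
    have "B2 (L_op phi00 (D_times (u_fun \<alpha>))) (L_op phi00 (u_fun \<beta>))
        = B2 (L_op phi00 (u_fun \<alpha>)) (L_op phi00 (D_times (u_fun \<beta>)))"
      using assms(7) mem that by (auto simp: self_adjoint_pair_def)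
    thus "B2 (fscale (- \<alpha>) (L_op phi00 (u_fun \<alpha>))) (L_op phi00 (u_fun \<beta>))
        = B2 (L_op phi00 (u_fun \<alpha>)) (fscale (- \<beta>) (L_op phi00 (u_fun \<beta>)))"
      by (simp only: L_op_D_times_u_fun)
    show "- \<alpha> \<noteq> cnj (- \<beta>)" using that(3) by simp
  qed
  have "\<alpha> \<noteq> cnj \<alpha>" if "\<alpha> \<notin> \<real>" for \<alpha>
    using that Reals_cnj_iff by metis
  thus ?thesis using B1 orth by simp
qed

end
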